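(* Let $X$ and $Y$ be nonempty sets and let $f,g: X\times Y\to\mathbb{R}$ be two functions. Suppose that: (i) for every $y\in Y$ the function $f(\cdot,y)$ is bounded on $X$, and $f$ is $t$-convexlike on $X$ for some $t\in(0,1)$; (ii) for every net $(x_\alpha)_\alpha\subset X$, $$\inf_{x\in X}\sup_{y\in Y} f(x,y)\leq \sup_{y\in Y}\limsup_\alpha f(x_\alpha,y);$$ (iii) $g$ is supinf-concave on $Y$; (iv) $f\leq g$ on $X\times Y$. Then $$\inf_{x\in X}\sup_{y\in Y} f(x,y)\leq \sup_{y\in Y}\inf_{x\in X} g(x,y).$$
   Context: Infima and suprema are taken in the extended reals. $f:X\times Y\to\mathbb{R}$ is $t$-convexlike on $X$ if for all $x_1,x_2\in X$ there exists $x_3\in X$ such that $f(x_3,y)\leq t f(x_1,y)+(1-t)f(x_2,y)$ for all $y\in Y$. For $n\ge 1$, $\Delta_n=\{(\lambda_1,\dots,\lambda_n)\in\mathbb{R}_+^n:\sum_{i=1}^n\lambda_i=1\}$. A function $g:X\times Y\to\mathbb{R}$ is supinf-concave on $Y$ if $$\sup_{y\in Y}\inf_{x\in X} g(x,y)=\sup_{n\geq 1,\ y_1,\dots,y_n\in Y,\ (\lambda_1,\dots,\lambda_n)\in\Delta_n}\ \inf_{x\in X}\sum_{i=1}^n\lambda_i g(x,y_i).$$ *)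

theory Defs
  imports "HOL-Analysis.Analysis"
begin

definition t_convexlike_on :: "real \<Rightarrow> 'a set \<Rightarrow> 'b set \<Rightarrow> ('a \<Rightarrow> 'b \<Rightarrow> real) \<Rightarrow> bool" where
  "t_convexlike_on t X Y f \<longleftrightarrow>
     (\<forall>x1\<in>X. \<forall>x2\<in>X. \<exists>x3\<in>X. \<forall>y\<in>Y. f x3 y \<le> t * f x1 y + (1 - t) * f x2 y)"

(* Only the values at the indices 1, ..., n matter. *)
definition std_simplex :: "nat \<Rightarrow> (nat \<Rightarrow> real) set" where
  "std_simplex n = {l. (\<forall>i\<in>{1..n}. 0 \<le> l i) \<and> (\<Sum>i=1..n. l i) = 1}"

definition supinf_concave_on :: "'a set \<Rightarrow> 'b set \<Rightarrow> ('a \<Rightarrow> 'b \<Rightarrow> real) \<Rightarrow> bool" where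
  "supinf_concave_on X Y g \<longleftrightarrow>
     (SUP y\<in>Y. INF x\<in>X. ereal (g x y)) =
     Sup {INF x\<in>X. ereal (\<Sum>i=1..n. l i * g x (y i)) | n y l.
            1 \<le> n \<and> (\<forall>i\<in>{1..n}. y i \<in> Y) \<and> l \<in> std_simplex n}"

definition directed_set :: "'i set \<Rightarrow> ('i \<Rightarrow> 'i \<Rightarrow> bool) \<Rightarrow> bool" where
  "directed_set D le \<longleftrightarrow> D \<noteq> {} \<and> reflp_on D le \<and> transp_on D le \<and>
     (\<forall>a\<in>D. \<forall>b\<in>D. \<exists>c\<in>D. le a c \<and> le b c)"

definition net_in :: "'i set \<Rightarrow> ('i \<Rightarrow> 'i \<Rightarrow> bool) \<Rightarrow> ('i \<Rightarrow> 'a) \<Rightarrow> 'a set \<Rightarrow> bool" where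
  "net_in D le u X \<longleftrightarrow> directed_set D le \<and> u ` D \<subseteq> X"

definition net_limsup :: "'i set \<Rightarrow> ('i \<Rightarrow> 'i \<Rightarrow> bool) \<Rightarrow> ('i \<Rightarrow> ereal) \<Rightarrow> ereal" where
  "net_limsup D le h = (INF a\<in>D. SUP b\<in>{b \<in> D. le a b}. h b)"

(* HOL cannot quantify over the index type of a net inside a formula. The next lemma shows
   that index sets in the single type 'a set \<times> 'a lose nothing for nets in a subset of 'a:
   each net, with any index type, can be replaced by one indexed by pairs of a tail and a
   point of it, which has the same limsup along every function. *)
lemma net_limsup_canonical_index:
  fixes D :: "'i set" and u :: "'i \<Rightarrow> 'a"
  assumes "net_in D le u X"
  obtains E :: "('a set \<times> 'a) set" and le' v where "net_in E le' v X"
    and "\<And>h. net_limsup E le' (\<lambda>a. h (v a)) = net_limsup D le (\<lambda>a. h (u a))"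
proof -
  define T where "T a = u ` {b \<in> D. le a b}" for a
  define E where "E = {(S, z). z \<in> S \<and> S \<in> T ` D}"
  define le' :: "'a set \<times> 'a \<Rightarrow> 'a set \<times> 'a \<Rightarrow> bool" where "le' p q \<longleftrightarrow> fst q \<subseteq> fst p" for p q
  have dir: "directed_set D le" and uX: "u ` D \<subseteq> X"
    using assms by (auto simp: net_in_def)
  have self: "u a \<in> T a" if "a \<in> D" for a
    using dir that by (auto simp: T_def directed_set_def reflp_on_def)
  have mono: "T b \<subseteq> T a" if "a \<in> D" "b \<in> D" "le a b" for a b
    using dir that by (auto simp: T_def directed_set_def dest: transp_onD)
  have inE: "(T a, u a) \<in> E" if "a \<in> D" for a
    using self that by (auto simp: E_def)
  have "\<exists>c\<in>E. le' p c \<and> le' q c" if pq: "p \<in> E" "q \<in> E" for p q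
  proof -
    obtain a b where ab: "a \<in> D" "b \<in> D" "fst p = T a" "fst q = T b"
      using pq by (auto simp: E_def)
    then obtain c where "c \<in> D" "le a c" "le b c"
      using dir unfolding directed_set_def by blast
    then show ?thesis
      using ab mono inE by (intro bexI[of _ "(T c, u c)"]) (auto simp: le'_def)
  qed
  moreover have "E \<noteq> {}"
    using dir inE by (auto simp: directed_set_def)
  ultimately have "directed_set E le'"
    by (auto simp: directed_set_def le'_def reflp_on_def transp_on_def)
  moreover have "snd ` E \<subseteq> X"
    using uX by (auto simp: E_def T_def)
  ultimately have net: "net_in E le' snd X"
    by (simp add: net_in_def)
  have "net_limsup E le' (\<lambda>a. h (snd a)) = net_limsup D le (\<lambda>a. h (u a))" for h
  proof -
    have tail: "(SUP q\<in>{q \<in> E. le' p q}. h (snd q)) = (SUP z\<in>fst p. h z)" if "p \<in> E" for p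
    proof -
      have "snd ` {q \<in> E. le' p q} = fst p"
        using that by (force simp: E_def le'_def image_iff)
      then have "h ` snd ` {q \<in> E. le' p q} = h ` fst p"
        by (rule arg_cong)
      then show ?thesis
        unfolding image_image by (rule arg_cong)
    qed
    have "fst ` E = T ` D"
      using inE by (force simp: E_def)
    then have "(\<lambda>S. SUP z\<in>S. h z) ` fst ` E = (\<lambda>S. SUP z\<in>S. h z) ` T ` D"
      by (rule arg_cong)
    then have "(INF p\<in>E. SUP z\<in>fst p. h z) = (INF a\<in>D. SUP z\<in>T a. h z)"
      unfolding image_image by (rule arg_cong)
    moreover have "net_limsup E le' (\<lambda>a. h (snd a)) = (INF p\<in>E. SUP z\<in>fst p. h z)"
      unfolding net_limsup_def by (intro INF_cong refl tail)
    moreover have "net_limsup D le (\<lambda>a. h (u a)) = (INF a\<in>D. SUP z\<in>T a. h z)"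
      unfolding net_limsup_def T_def image_image by (rule refl)
    ultimately show ?thesis
      by simp
  qed
  with net show thesis
    by (rule that)
qed

end

theory Submission
  imports Defs
begin

text \<open>
  If the conclusion fails, fix a real \<open>c\<close> and a slightly larger \<open>d\<close> strictly between the two sides.
  Every finite \<open>F \<subseteq> Y\<close> admits an \<open>x\<^sub>F\<close> with \<open>f x\<^sub>F \<le> d\<close> on \<open>F\<close>; these points form a net indexed by
  the finite subsets of \<open>Y\<close>, which contradicts (ii). To find \<open>x\<^sub>F\<close>, minimise the penalty
  \<open>\<phi>(x) = \<Sum>y\<in>F. (max 0 (f x y - c))\<^sup>2\<close>. At an almost minimal \<open>x\<^sub>1\<close>, take the weights proportional
  to \<open>max 0 (f x\<^sub>1 y - c)\<close>; supinf-concavity and \<open>f \<le> g\<close> give an \<open>x\<^sub>2\<close> whose weighted mean is at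
  most \<open>c\<close>, so moving a little from \<open>x\<^sub>1\<close> towards \<open>x\<^sub>2\<close> decreases \<open>\<phi>\<close> to first order. Boundedness
  of \<open>f\<close> controls the second-order term uniformly, so the infimum of \<open>\<phi>\<close> is \<open>0\<close>.
\<close>

lemma t_convexlike_on_subset:
  "t_convexlike_on t X Y f \<Longrightarrow> F \<subseteq> Y \<Longrightarrow> t_convexlike_on t X F f"
  unfolding t_convexlike_on_def by (meson subsetD)

text \<open>Since \<open>t\<close> is fixed, small steps come from iteration: combining
  \<open>x1\<close> with the previous point multiplies the displacement towards \<open>x2\<close> by
  \<open>1 - t\<close>.\<close>

lemma t_convexlike_on_power:
  assumes conv: "t_convexlike_on t X Y f" and t: "0 < t" "t < 1" and x: "x1 \<in> X" "x2 \<in> X"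
  shows "\<exists>x3\<in>X. \<forall>y\<in>Y. f x3 y \<le> f x1 y + (1 - t) ^ k * (f x2 y - f x1 y)"
proof (induction k)
  case 0
  then show ?case using x by auto
next
  case (Suc k)
  then obtain z where z: "z \<in> X" "\<And>y. y \<in> Y \<Longrightarrow> f z y \<le> f x1 y + (1 - t) ^ k * (f x2 y - f x1 y)"
    by blast
  obtain w where w: "w \<in> X" "\<And>y. y \<in> Y \<Longrightarrow> f w y \<le> t * f x1 y + (1 - t) * f z y"
    using conv x z unfolding t_convexlike_on_def by meson
  have "f w y \<le> f x1 y + (1 - t) ^ Suc k * (f x2 y - f x1 y)" if "y \<in> Y" for y
  proof -
    have "(1 - t) * f z y \<le> (1 - t) * (f x1 y + (1 - t) ^ k * (f x2 y - f x1 y))"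
      using z(2)[OF that] t by (intro mult_left_mono) auto
    then show ?thesis
      using w(2)[OF that] by (simp add: algebra_simps)
  qed
  with w(1) show ?case by blast
qed

text \<open>A second-order bound for the squared positive part without case distinctions for the
  user: if \<open>a + h > 0\<close>, then \<open>max 0 a + h\<close> is at least
  \<open>a + h\<close>; otherwise the left side is 0.\<close>

lemma pos_part_add_square_le:
  fixes a h :: real
  shows "(max 0 (a + h))\<^sup>2 \<le> (max 0 a)\<^sup>2 + 2 * (max 0 a * h) + h\<^sup>2"
proof -
  have "(max 0 (a + h))\<^sup>2 \<le> (max 0 a + h)\<^sup>2"
    by (rule abs_le_square_iff[THEN iffD1]) (auto simp: max_def)
  then show ?thesis by (simp add: power2_sum)
qed

lemma t_convexlike_finite_alternative:
  fixes f :: "'a \<Rightarrow> 'b \<Rightarrow> real"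
  assumes "X \<noteq> {}" "finite F"
    and bdd: "\<And>y. y \<in> F \<Longrightarrow> bounded ((\<lambda>x. f x y) ` X)"
    and t: "0 < t" "t < 1" and conv: "t_convexlike_on t X F f"
    and mean: "\<And>w. (\<And>y. y \<in> F \<Longrightarrow> 0 \<le> w y) \<Longrightarrow> sum w F = 1 \<Longrightarrow> \<exists>x\<in>X. (\<Sum>y\<in>F. w y * f x y) \<le> c"
    and "c < d"
  shows "\<exists>x\<in>X. \<forall>y\<in>F. f x y \<le> d"
proof -
  define p where "p x y = max 0 (f x y - c)" for x y
  define \<phi> where "\<phi> x = (\<Sum>y\<in>F. (p x y)\<^sup>2)" for x
  define m where "m = (INF x\<in>X. \<phi> x)"
  have p0: "0 \<le> p x y" for x y by (simp add: p_def)
  have \<phi>0: "0 \<le> \<phi> x" for x by (simp add: \<phi>_def sum_nonneg)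
  have bb: "bdd_below (\<phi> ` X)" using \<phi>0 by (auto simp: bdd_below_def)
  have m_le: "m \<le> \<phi> x" if "x \<in> X" for x
    unfolding m_def using bb that by (rule cINF_lower)
  have approx: "\<exists>x\<in>X. \<phi> x < e" if "m < e" for e
    using that \<open>X \<noteq> {}\<close> bb unfolding m_def by (simp add: cINF_less_iff)
  have "\<forall>y\<in>F. \<exists>B. \<forall>x\<in>X. \<bar>f x y\<bar> \<le> B"
    using bdd by (auto simp: bounded_iff)
  then obtain B where B: "\<And>x y. y \<in> F \<Longrightarrow> x \<in> X \<Longrightarrow> \<bar>f x y\<bar> \<le> B y"
    by metis
  \<comment> \<open>Bounds the squared displacement between any two points of \<open>X\<close>,
    summed over \<open>F\<close>. It is fixed before the step size and the almost minimiser are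
    chosen.\<close>
  define K where "K = (\<Sum>y\<in>F. (2 * B y)\<^sup>2)"
  have K0: "0 \<le> K" by (simp add: K_def sum_nonneg)
  have "m \<le> 0"
  proof (rule ccontr)
    assume "\<not> m \<le> 0"
    then have m: "0 < m" by simp
    \<comment> \<open>The bound 1/2 keeps \<open>1 - 2 * s\<close> positive; the other one makes the
      second-order term at most \<open>s * m\<close>.\<close>
    obtain k where k: "(1 - t) ^ k < min (1/2) (m / (K + 1))"
      using real_arch_pow_inv[of "min (1/2) (m / (K + 1))" "1 - t"] t m K0 by auto
    define s where "s = (1 - t) ^ k"
    have s: "0 < s" "s < 1/2" "s < m / (K + 1)" using k t by (auto simp: s_def)
    have sK: "s\<^sup>2 * K \<le> s * m"
    proof -
      have "s * (K + 1) < m" using s(3) K0 by (simp add: field_simps)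
      then have "s * K \<le> m" using s(1) by (simp add: algebra_simps)
      then have "s * (s * K) \<le> s * m" using s(1) by (intro mult_left_mono) auto
      then show ?thesis by (simp add: power2_eq_square)
    qed
    \<comment> \<open>The infimum need not be attained. The excess \<open>s * m\<close> and the
      second-order term \<open>s * m\<close> are together outweighed by the first-order gain
      \<open>2 * s * \<phi> x1\<close>.\<close>
    obtain x1 where x1: "x1 \<in> X" "\<phi> x1 < m * (1 + s)"
      using approx[of "m * (1 + s)"] m s by auto
    define P where "P = (\<Sum>y\<in>F. p x1 y)"
    have "P \<noteq> 0"
    proof
      assume "P = 0"
      then have "\<forall>y\<in>F. p x1 y = 0"
        unfolding P_def using \<open>finite F\<close> p0 by (subst (asm) sum_nonneg_eq_0_iff) auto
      then have "\<phi> x1 = 0" by (simp add: \<phi>_def)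
      with m_le[OF x1(1)] m show False by simp
    qed
    moreover have "0 \<le> P" using p0 by (simp add: P_def sum_nonneg)
    ultimately have P: "0 < P" by simp
    obtain x2 where x2: "x2 \<in> X" "(\<Sum>y\<in>F. p x1 y / P * f x2 y) \<le> c"
      using mean[of "\<lambda>y. p x1 y / P"] p0 P by (auto simp: P_def simp flip: sum_divide_distrib)
    have "(\<Sum>y\<in>F. p x1 y * f x2 y) \<le> P * c"
      using x2(2) P by (simp add: field_simps flip: sum_divide_distrib)
    then have mean2: "(\<Sum>y\<in>F. p x1 y * (f x2 y - c)) \<le> 0"
      by (simp add: P_def right_diff_distrib sum_subtractf sum_distrib_right)
    have first_order: "(\<Sum>y\<in>F. p x1 y * (f x2 y - f x1 y)) \<le> - \<phi> x1"
    proof -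
      \<comment> \<open>Where \<open>f x1 y < c\<close> the factor \<open>p x1 y\<close> vanishes;
        elsewhere it equals \<open>f x1 y - c\<close>.\<close>
      have "p x1 y * (f x2 y - f x1 y) = p x1 y * (f x2 y - c) - (p x1 y)\<^sup>2" for y
        by (simp add: p_def max_def power2_eq_square algebra_simps)
      then show ?thesis using mean2 by (simp add: \<phi>_def sum_subtractf)
    qed
    obtain x3 where x3: "x3 \<in> X" "\<And>y. y \<in> F \<Longrightarrow> f x3 y \<le> f x1 y + s * (f x2 y - f x1 y)"
      using t_convexlike_on_power[OF conv t x1(1) x2(1), of k] unfolding s_def by blast
    have "(p x3 y)\<^sup>2 \<le> (p x1 y)\<^sup>2 + 2 * s * (p x1 y * (f x2 y - f x1 y)) + s\<^sup>2 * (2 * B y)\<^sup>2"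
      if y: "y \<in> F" for y
    proof -
      define h where "h = s * (f x2 y - f x1 y)"
      have "(p x3 y)\<^sup>2 \<le> (max 0 (f x1 y - c + h))\<^sup>2"
        using x3(2)[OF y] by (intro power_mono) (auto simp: p_def h_def)
      also have "\<dots> \<le> (p x1 y)\<^sup>2 + 2 * (p x1 y * h) + h\<^sup>2"
        unfolding p_def by (rule pos_part_add_square_le)
      also have "h\<^sup>2 \<le> s\<^sup>2 * (2 * B y)\<^sup>2"
      proof -
        have "\<bar>f x2 y - f x1 y\<bar> \<le> \<bar>2 * B y\<bar>"
          using B[OF y x1(1)] B[OF y x2(1)] by linarith
        then have "(f x2 y - f x1 y)\<^sup>2 \<le> (2 * B y)\<^sup>2" by (simp only: abs_le_square_iff)
        then show ?thesis unfolding h_def power_mult_distrib[of s]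
          by (intro mult_left_mono) auto
      qed
      finally show ?thesis by (simp add: h_def algebra_simps)
    qed
    then have "\<phi> x3 \<le> (\<Sum>y\<in>F. (p x1 y)\<^sup>2 + 2 * s * (p x1 y * (f x2 y - f x1 y)) + s\<^sup>2 * (2 * B y)\<^sup>2)"
      unfolding \<phi>_def by (rule sum_mono)
    also have "\<dots> = \<phi> x1 + 2 * s * (\<Sum>y\<in>F. p x1 y * (f x2 y - f x1 y)) + s\<^sup>2 * K"
      by (simp only: sum.distrib \<phi>_def K_def flip: sum_distrib_left)
    also have "\<dots> \<le> \<phi> x1 + 2 * s * (- \<phi> x1) + s * m"
      using first_order sK s(1) by (intro add_mono mult_left_mono) auto
    also have "\<dots> = (1 - 2 * s) * \<phi> x1 + s * m" by (simp add: algebra_simps)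
    also have "\<dots> \<le> (1 - 2 * s) * (m * (1 + s)) + s * m"
      using x1(2) s by (intro add_mono mult_left_mono) auto
    also have "\<dots> = m - 2 * (s\<^sup>2 * m)" by (simp add: algebra_simps power2_eq_square)
    also have "\<dots> < m" using s m by simp
    finally show False using m_le[OF x3(1)] by simp
  qed
  \<comment> \<open>A penalty below this threshold forces every single excess over \<open>c\<close>
    below \<open>d - c\<close>.\<close>
  then have "m < (d - c)\<^sup>2" using \<open>c < d\<close> by (smt (verit) zero_less_power)
  then obtain x where x: "x \<in> X" "\<phi> x < (d - c)\<^sup>2"
    using approx by blast
  have "f x y \<le> d" if "y \<in> F" for y
  proof -
    have "(p x y)\<^sup>2 \<le> \<phi> x"
      unfolding \<phi>_def using \<open>finite F\<close> that by (intro member_le_sum) auto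
    then have "(p x y)\<^sup>2 < (d - c)\<^sup>2" using x(2) by simp
    then have "p x y < d - c" using \<open>c < d\<close> by (simp add: power2_less_imp_less)
    then show ?thesis by (simp add: p_def)
  qed
  with x(1) show ?thesis by blast
qed

text \<open>Enumerating \<open>F\<close> turns weights on a finite set into a point of the simplex;
  \<open>F\<close> is nonempty because the weights sum to 1.\<close>

lemma supinf_concave_onD:
  assumes conc: "supinf_concave_on X Y g" and "finite F" "F \<subseteq> Y"
    and w: "\<And>y. y \<in> F \<Longrightarrow> 0 \<le> w y" "sum w F = 1"
  shows "(INF x\<in>X. ereal (\<Sum>y\<in>F. w y * g x y)) \<le> (SUP y\<in>Y. INF x\<in>X. ereal (g x y))"
proof -
  obtain e where e: "bij_betw e {1..card F} F"
    using ex_bij_betw_nat_finite_1[OF \<open>finite F\<close>] by blast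
  have sum_e: "(\<Sum>i=1..card F. h (e i)) = sum h F" for h :: "'b \<Rightarrow> real"
    using e by (rule sum.reindex_bij_betw)
  have eF: "e i \<in> F" if "i \<in> {1..card F}" for i
    using bij_betwE[OF e] that by blast
  have "1 \<le> card F" using w(2) \<open>finite F\<close> by (cases "F = {}") (auto simp: Suc_le_eq card_gt_0_iff)
  moreover have "\<forall>i\<in>{1..card F}. e i \<in> Y" using eF \<open>F \<subseteq> Y\<close> by blast
  moreover have "(\<lambda>i. w (e i)) \<in> std_simplex (card F)"
    using eF w sum_e[of w] by (simp add: std_simplex_def)
  moreover have "(INF x\<in>X. ereal (\<Sum>y\<in>F. w y * g x y)) =
      (INF x\<in>X. ereal (\<Sum>i=1..card F. w (e i) * g x (e i)))"
    by (simp only: sum_e[of "\<lambda>y. w y * g x y" for x])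
  ultimately show ?thesis
    unfolding conc[unfolded supinf_concave_on_def]
    by (intro Sup_upper CollectI exI[of _ "card F"] exI[of _ e] exI[of _ "\<lambda>i. w (e i)"]) simp
qed

theorem theorem2:
  fixes X :: "'a set" and Y :: "'b set" and f g :: "'a \<Rightarrow> 'b \<Rightarrow> real"
  assumes "X \<noteq> {}" and "Y \<noteq> {}"
    and "\<forall>y\<in>Y. bounded ((\<lambda>x. f x y) ` X)"
    and "\<exists>t. 0 < t \<and> t < 1 \<and> t_convexlike_on t X Y f"
    and "\<And>(D :: ('a set \<times> 'a) set) le u. net_in D le u X \<Longrightarrow>
           (INF x\<in>X. SUP y\<in>Y. ereal (f x y)) \<le>
           (SUP y\<in>Y. net_limsup D le (\<lambda>a. ereal (f (u a) y)))"
    and "supinf_concave_on X Y g"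
    and "\<forall>x\<in>X. \<forall>y\<in>Y. f x y \<le> g x y"
  shows "(INF x\<in>X. SUP y\<in>Y. ereal (f x y)) \<le> (SUP y\<in>Y. INF x\<in>X. ereal (g x y))"
proof (rule ccontr)
  assume "\<not> ?thesis"
  then have "(SUP y\<in>Y. INF x\<in>X. ereal (g x y)) < (INF x\<in>X. SUP y\<in>Y. ereal (f x y))"
    by simp
  then obtain d where d: "(SUP y\<in>Y. INF x\<in>X. ereal (g x y)) < ereal d"
      "ereal d < (INF x\<in>X. SUP y\<in>Y. ereal (f x y))"
    using ereal_dense2 by blast
  obtain c where c: "(SUP y\<in>Y. INF x\<in>X. ereal (g x y)) < ereal c" "c < d"
    using ereal_dense2[OF d(1)] by auto
  obtain t where t: "0 < t" "t < 1" and conv: "t_convexlike_on t X Y f"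
    using assms(4) by blast
  have "\<exists>x\<in>X. \<forall>y\<in>F. f x y \<le> d" if F: "finite F" "F \<subseteq> Y" for F
  proof (rule t_convexlike_finite_alternative[OF \<open>X \<noteq> {}\<close> F(1) _ t _ _ c(2)])
    show "bounded ((\<lambda>x. f x y) ` X)" if "y \<in> F" for y
      using assms(3) F(2) that by blast
    show "t_convexlike_on t X F f" using conv F(2) by (rule t_convexlike_on_subset)
    show "\<exists>x\<in>X. (\<Sum>y\<in>F. w y * f x y) \<le> c" if w: "\<And>y. y \<in> F \<Longrightarrow> 0 \<le> w y" "sum w F = 1" for w
    proof -
      have "(INF x\<in>X. ereal (\<Sum>y\<in>F. w y * g x y)) < ereal c"
        using supinf_concave_onD[OF assms(6) F w] c(1) by (rule le_less_trans)
      then obtain x where x: "x \<in> X" "(\<Sum>y\<in>F. w y * g x y) < c"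
        by (auto simp: INF_less_iff)
      have "(\<Sum>y\<in>F. w y * f x y) \<le> (\<Sum>y\<in>F. w y * g x y)"
        using assms(7) F(2) w(1) x(1) by (intro sum_mono mult_left_mono) auto
      with x show ?thesis by (intro bexI[of _ x]) auto
    qed
  qed
  then obtain u where u: "\<And>F. finite F \<Longrightarrow> F \<subseteq> Y \<Longrightarrow> u F \<in> X"
      "\<And>F y. finite F \<Longrightarrow> F \<subseteq> Y \<Longrightarrow> y \<in> F \<Longrightarrow> f (u F) y \<le> d"
    by metis
  define D where "D = {F. finite F \<and> F \<subseteq> Y}"
  have "\<exists>C\<in>D. A \<subseteq> C \<and> B \<subseteq> C" if "A \<in> D" "B \<in> D" for A B
    using that by (intro bexI[of _ "A \<union> B"]) (auto simp: D_def)
  then have "net_in D (\<subseteq>) u X"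
    using u(1) by (auto simp: net_in_def directed_set_def D_def reflp_on_def transp_on_def)
  \<comment> \<open>The net \<open>u\<close> is indexed by subsets of \<open>Y\<close>, so it is
    transferred to the index type for which (ii) is assumed.\<close>
  then obtain E :: "('a set \<times> 'a) set" and le v where E: "net_in E le v X"
      "\<And>h. net_limsup E le (\<lambda>a. h (v a)) = net_limsup D (\<subseteq>) (\<lambda>a. h (u a))"
    by (rule net_limsup_canonical_index) (rule that)
  have "net_limsup E le (\<lambda>a. ereal (f (v a) y)) \<le> ereal d" if "y \<in> Y" for y
  proof -
    have "net_limsup D (\<subseteq>) (\<lambda>a. ereal (f (u a) y)) \<le> ereal d"
      unfolding net_limsup_def
      \<comment> \<open>Every index beyond \<open>{y}\<close> contains \<open>y\<close>, so the
        whole tail is bounded by \<open>d\<close>.\<close>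
      by (rule INF_lower2[of "{y}"]) (use that u(2) in \<open>auto simp: D_def intro!: SUP_least\<close>)
    then show ?thesis using E(2)[of "\<lambda>x. ereal (f x y)"] by simp
  qed
  then have "(SUP y\<in>Y. net_limsup E le (\<lambda>a. ereal (f (v a) y))) \<le> ereal d"
    by (rule SUP_least)
  with assms(5)[OF E(1)] d(2) show False by simp
qed

end
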